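(* Let $\alpha\ge\omega$ be an ordinal and let $\mathcal{G}$ be the family of all finite unions of sets of the form $\{r\in[0,1)^\alpha: r_{k_1}\in I_1,\dots,r_{k_n}\in I_n\}$, where $n\in\omega$, $k_1<\dots<k_n<\alpha$, and each $I_j=[s_j,t_j)$ with $0\le s_j<t_j\le 1$. Let $\lambda$ be the restriction to $\mathcal{G}$ of the product of countably many (indeed $\alpha$ many) copies of Lebesgue measure on $[0,1)$, so that $\lambda(\{r: r_{k_1}\in I_1,\dots,r_{k_n}\in I_n\})=\prod_j (t_j-s_j)$. Then $\mathcal{G}$ is a set algebra with unit $[0,1)^\alpha$ closed under all cylindrifications $C_k$ and all substitutions $a\mapsto a(k/l)$ (a polyadic set algebra), and for every $a\in\mathcal{G}$, every $y\in\Delta a$ and every sequence $y_1,y_2,\dots$ of pairwise distinct ordinals $<\alpha$ not in $\Delta a$, $$\lambda(C_y a)=\sup_{n\in\omega}\lambda\Big(\bigcup_{i=1}^n a(y/y_i)\Big).$$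
   Context: Here $T=[0,1)$. For $r\in T^\alpha$, $k<\alpha$, $u\in T$, $r^k_u$ is $r$ with its $k$-th coordinate replaced by $u$. Cylindrification: $C_k a=\{r\in T^\alpha: r^k_u\in a\text{ for some }u\in T\}$. Dimension set: $\Delta a=\{k<\alpha: C_k a\neq a\}$. Substitution: $a(k/l)=\{r\in T^\alpha: r^k_{r_l}\in a\}$. *)

theory Defs
  imports "HOL-Analysis.Analysis"
begin

text \<open>
  An ordinal \<open>\<alpha>\<close> is represented by a well-ordered index type \<^typ>\<open>'k\<close>, whose elements play the
  role of the ordinals below \<open>\<alpha>\<close>; \<open>\<alpha> \<ge> \<omega>\<close> then means that \<^term>\<open>UNIV :: 'k set\<close> is infinite.
\<close>

definition unit_cube :: "('k \<Rightarrow> real) set"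
  where "unit_cube = UNIV \<rightarrow> {0..<1}"

definition cyl :: "'k \<Rightarrow> ('k \<Rightarrow> real) set \<Rightarrow> ('k \<Rightarrow> real) set"
  where "cyl k a = {r \<in> unit_cube. \<exists>u\<in>{0..<1}. r(k := u) \<in> a}"

definition dim_set :: "('k \<Rightarrow> real) set \<Rightarrow> 'k set"
  where "dim_set a = {k. cyl k a \<noteq> a}"

text \<open>\<^term>\<open>subst_set a k l\<close> is the set written \<open>a(k/l)\<close>.\<close>

definition subst_set :: "('k \<Rightarrow> real) set \<Rightarrow> 'k \<Rightarrow> 'k \<Rightarrow> ('k \<Rightarrow> real) set"
  where "subst_set a k l = {r \<in> unit_cube. r(k := r l) \<in> a}"

definition polyadic_set_algebra :: "('k \<Rightarrow> real) set set \<Rightarrow> bool"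
  where "polyadic_set_algebra A \<longleftrightarrow>
    algebra unit_cube A \<and>
    (\<forall>k. \<forall>a\<in>A. cyl k a \<in> A) \<and>
    (\<forall>k l. \<forall>a\<in>A. subst_set a k l \<in> A)"

text \<open>
  The side conditions on the data \<open>k\<^sub>1 < \<dots> < k\<^sub>n\<close>, \<open>I\<^sub>j = [s\<^sub>j, t\<^sub>j)\<close> of a box. Only the values
  at the positions \<open>1, \<dots>, n\<close> matter; \<open>n = 0\<close> gives the whole cube.
\<close>

definition box_data :: "nat \<Rightarrow> (nat \<Rightarrow> 'k::wellorder) \<Rightarrow> (nat \<Rightarrow> real) \<Rightarrow> (nat \<Rightarrow> real) \<Rightarrow> bool"
  where "box_data n k s t \<longleftrightarrow>
    strict_mono_on {1..n} k \<and> (\<forall>j\<in>{1..n}. 0 \<le> s j \<and> s j < t j \<and> t j \<le> 1)"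

definition fin_box :: "nat \<Rightarrow> (nat \<Rightarrow> 'k) \<Rightarrow> (nat \<Rightarrow> real) \<Rightarrow> (nat \<Rightarrow> real) \<Rightarrow> ('k \<Rightarrow> real) set"
  where "fin_box n k s t = {r \<in> unit_cube. \<forall>j\<in>{1..n}. r (k j) \<in> {s j..<t j}}"

text \<open>The union of the empty family is included, so \<open>{}\<close> belongs to \<open>\<G>\<close>.\<close>

definition box_algebra :: "('k::wellorder \<Rightarrow> real) set set"
  where "box_algebra =
    {\<Union>F |F. finite F \<and> F \<subseteq> {fin_box n k s t |n k s t. box_data n k s t}}"

definition cube_measure :: "('k \<Rightarrow> real) measure"
  where "cube_measure = PiM UNIV (\<lambda>_. lebesgue_on {0..<1})"

end

theory Submission
  imports Defs "HOL-Probability.Infinite_Product_Measure"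
begin

text \<open>
  A set belongs to \<open>\<G>\<close> iff membership of \<open>r\<close> is decided by the comparisons \<open>p \<le> r k\<close> with \<open>k\<close> and
  \<open>p\<close> ranging over finite sets; in this form all closure properties are immediate.
  For the measure identity, if \<open>r \<in> C\<^sub>y a\<close> then \<open>r\<^sup>y\<^sub>u \<in> a\<close> for all \<open>u\<close> in some interval with rational
  end points \<open>q < q'\<close>, so \<open>r\<close> lies in some \<open>a(y/y\<^sub>i)\<close> unless \<open>r\<close> avoids \<open>[q, q')\<close> at
  all coordinates \<open>y\<^sub>i\<close>, which happens with probability \<open>lim (1 - (q' - q))\<^sup>n = 0\<close>. A countable union
  over \<open>q, q'\<close> and continuity from below finish the proof.
\<close>

section \<open>Sets decided by finitely many comparisons\<close>

definition grid_eq :: "'k set \<Rightarrow> real set \<Rightarrow> ('k \<Rightarrow> real) \<Rightarrow> ('k \<Rightarrow> real) \<Rightarrow> bool"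
  where "grid_eq K P r r' \<longleftrightarrow> (\<forall>k\<in>K. \<forall>p\<in>P. p \<le> r k \<longleftrightarrow> p \<le> r' k)"

text \<open>Saturation under the equivalence relation \<open>grid_eq K P\<close> on the cube. One
  implication expresses it, since the relation is symmetric.\<close>

definition grid_invariant :: "'k set \<Rightarrow> real set \<Rightarrow> ('k \<Rightarrow> real) set \<Rightarrow> bool"
  where "grid_invariant K P a \<longleftrightarrow>
    (\<forall>r\<in>unit_cube. \<forall>r'\<in>unit_cube. grid_eq K P r r' \<longrightarrow> r \<in> a \<longrightarrow> r' \<in> a)"

lemma grid_eq_sym: "grid_eq K P r r' \<Longrightarrow> grid_eq K P r' r"
  by (auto simp: grid_eq_def)

lemma grid_invariantD:
  "grid_invariant K P a \<Longrightarrow> r \<in> unit_cube \<Longrightarrow> r' \<in> unit_cube \<Longrightarrow> grid_eq K P r r' \<Longrightarrow> r \<in> a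
    \<Longrightarrow> r' \<in> a"
  by (auto simp: grid_invariant_def)

lemma grid_eq_antimono:
  "grid_eq K' P' r r' \<Longrightarrow> K \<subseteq> K' \<Longrightarrow> P \<subseteq> P' \<Longrightarrow> grid_eq K P r r'"
  by (auto simp: grid_eq_def)

lemma grid_invariant_mono:
  "grid_invariant K P a \<Longrightarrow> K \<subseteq> K' \<Longrightarrow> P \<subseteq> P' \<Longrightarrow> grid_invariant K' P' a"
  unfolding grid_invariant_def by (blast intro: grid_eq_antimono)

lemma unit_cube_apply: "r \<in> unit_cube \<Longrightarrow> 0 \<le> r k \<and> r k < 1"
  by (auto simp: unit_cube_def Pi_iff)

lemma unit_cube_upd: "r \<in> unit_cube \<Longrightarrow> u \<in> {0..<1} \<Longrightarrow> r(k := u) \<in> unit_cube"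
  by (auto simp: unit_cube_def Pi_iff)

section \<open>Grid cells are boxes\<close>

text \<open>The cell of \<open>u\<close> runs from the last grid point not above \<open>u\<close> to
  the first one above it. Testing with the non-strict \<open>p \<le> u\<close> is what makes it
  closed on the left and open on the right.\<close>

lemma grid_cell_interval:
  fixes P :: "real set"
  assumes "finite P" and u: "0 \<le> u" "u < 1"
  obtains s t where "0 \<le> s" "s \<le> u" "u < t" "t \<le> 1"
    and "\<And>v. 0 \<le> v \<Longrightarrow> v < 1 \<Longrightarrow> (\<forall>p\<in>P. p \<le> u \<longleftrightarrow> p \<le> v) \<longleftrightarrow> v \<in> {s..<t}"
proof
  \<comment> \<open>Adding 0 and 1 makes both sets nonempty and cuts the cell down to [0,1); every
    \<open>v\<close> in [0,1) satisfies the two added conditions anyway.\<close>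
  let ?S = "insert 0 {p\<in>P. p \<le> u}" and ?T = "insert 1 {p\<in>P. u < p}"
  have fin: "finite ?S" "finite ?T" using assms by auto
  show "0 \<le> Max ?S" using fin by simp
  show "Max ?S \<le> u" using fin u by simp
  show "u < Min ?T" using fin u by simp
  show "Min ?T \<le> 1" using fin by simp
  fix v :: real assume v: "0 \<le> v" "v < 1"
  have "v \<in> {Max ?S..<Min ?T} \<longleftrightarrow> (\<forall>p\<in>?S. p \<le> v) \<and> (\<forall>p\<in>?T. v < p)"
    using fin by simp
  also have "\<dots> \<longleftrightarrow> (\<forall>p\<in>P. p \<le> u \<longleftrightarrow> p \<le> v)"
    using v by force
  finally show "(\<forall>p\<in>P. p \<le> u \<longleftrightarrow> p \<le> v) \<longleftrightarrow> v \<in> {Max ?S..<Min ?T}" by simp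
qed

text \<open>A cell is a product of one interval per coordinate in \<open>K\<close>; listing
  \<open>K\<close> in increasing order turns it into box data.\<close>

lemma grid_cell_is_box:
  fixes r :: "'k::wellorder \<Rightarrow> real"
  assumes "finite K" "finite P" and r: "r \<in> unit_cube"
  obtains n k s t where "box_data n k s t" "{r'\<in>unit_cube. grid_eq K P r r'} = fin_box n k s t"
proof -
  \<comment> \<open>Pairing the two end points lets a single choice function deliver both.\<close>
  define I where "I k st \<longleftrightarrow> 0 \<le> fst st \<and> fst st < snd st \<and> snd st \<le> 1 \<and>
      (\<forall>v. 0 \<le> v \<longrightarrow> v < 1 \<longrightarrow> (\<forall>p\<in>P. p \<le> r k \<longleftrightarrow> p \<le> v) \<longleftrightarrow> v \<in> {fst st..<snd st})" for k st
  have "\<exists>st. I k st" for k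
  proof -
    have "0 \<le> r k" "r k < 1" using unit_cube_apply[OF r] by auto
    then show ?thesis
    proof (rule grid_cell_interval[OF \<open>finite P\<close>])
      fix s t assume "0 \<le> s" "s \<le> r k" "r k < t" "t \<le> 1"
        "\<And>v. 0 \<le> v \<Longrightarrow> v < 1 \<Longrightarrow> (\<forall>p\<in>P. p \<le> r k \<longleftrightarrow> p \<le> v) \<longleftrightarrow> v \<in> {s..<t}"
      then have "I k (s, t)" by (simp add: I_def)
      then show ?thesis ..
    qed
  qed
  then obtain f where f: "\<And>k. I k (f k)" by metis
  define s t where "s k = fst (f k)" and "t k = snd (f k)" for k
  have st: "0 \<le> s k" "s k < t k" "t k \<le> 1" for k
    using f[of k] by (auto simp: I_def s_def t_def)
  have cell: "(\<forall>p\<in>P. p \<le> r k \<longleftrightarrow> p \<le> v) \<longleftrightarrow> v \<in> {s k..<t k}" if "0 \<le> v" "v < 1" for k v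
    using f[of k] that by (simp add: I_def s_def t_def)
  \<comment> \<open>Positions in a box start at 1, list indices at 0.\<close>
  define e where "e j = sorted_list_of_set K ! (j - 1)" for j
  have len: "length (sorted_list_of_set K) = card K" by simp
  have mono: "strict_mono_on {1..card K} e"
  proof (rule strict_mono_onI)
    fix i j assume "i \<in> {1..card K}" "j \<in> {1..card K}" "i < j"
    then have "i - 1 < j - 1" "j - 1 < length (sorted_list_of_set K)" by auto
    then show "e i < e j"
      unfolding e_def by (rule sorted_wrt_nth_less[OF strict_sorted_list_of_set])
  qed
  have "e ` {1..card K} = (!) (sorted_list_of_set K) ` {..<card K}"
    unfolding e_def image_Suc_lessThan[symmetric] image_image by simp
  also have "\<dots> = set (sorted_list_of_set K)"
    using len by (auto simp: set_conv_nth)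
  finally have img: "e ` {1..card K} = K" using \<open>finite K\<close> by simp
  have "{r'\<in>unit_cube. grid_eq K P r r'} = {r'\<in>unit_cube. \<forall>k\<in>K. r' k \<in> {s k..<t k}}"
    unfolding grid_eq_def
    by (intro Collect_cong conj_cong ball_cong refl cell) (simp_all add: unit_cube_apply)
  also have "\<dots> = fin_box (card K) e (s \<circ> e) (t \<circ> e)"
    unfolding fin_box_def by (subst img[symmetric]) simp
  finally show thesis
    using mono st by (intro that[of "card K" e "s \<circ> e" "t \<circ> e"]) (simp_all add: box_data_def)
qed

section \<open>Grid invariance of boxes and its preservation under the operations\<close>

lemma fin_box_subset: "fin_box n k s t \<subseteq> unit_cube"
  by (auto simp: fin_box_def)

lemma grid_invariant_fin_box:
  "grid_invariant (k ` {1..n}) (s ` {1..n} \<union> t ` {1..n}) (fin_box n k s t)"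
  unfolding grid_invariant_def
proof (intro ballI impI)
  fix r r' assume r': "r' \<in> unit_cube" and r: "r \<in> fin_box n k s t"
    and eq: "grid_eq (k ` {1..n}) (s ` {1..n} \<union> t ` {1..n}) r r'"
  have "r' (k j) \<in> {s j..<t j}" if "j \<in> {1..n}" for j
  proof -
    have "s j \<le> r (k j) \<longleftrightarrow> s j \<le> r' (k j)" "t j \<le> r (k j) \<longleftrightarrow> t j \<le> r' (k j)"
      using eq that unfolding grid_eq_def by blast+
    moreover have "r (k j) \<in> {s j..<t j}" using r that by (simp add: fin_box_def)
    ultimately show ?thesis by auto
  qed
  then show "r' \<in> fin_box n k s t" using r' by (simp add: fin_box_def)
qed

lemma grid_invariant_Un:
  assumes "grid_invariant K P a" "grid_invariant K' P' b"
  shows "grid_invariant (K \<union> K') (P \<union> P') (a \<union> b)"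
  using grid_invariant_mono[OF assms(1), of "K \<union> K'" "P \<union> P'"]
    grid_invariant_mono[OF assms(2), of "K \<union> K'" "P \<union> P'"]
  unfolding grid_invariant_def by blast

lemma grid_invariant_Diff: "grid_invariant K P a \<Longrightarrow> grid_invariant K P (unit_cube - a)"
  unfolding grid_invariant_def using grid_eq_sym by (metis Diff_iff)

text \<open>Equivalent points remain equivalent when both get the same value at \<open>k\<close>, so
  one witness \<open>u\<close> serves for both.\<close>

lemma grid_invariant_cyl:
  assumes "grid_invariant K P a"
  shows "grid_invariant K P (cyl k a)"
  unfolding grid_invariant_def
proof (intro ballI impI)
  fix r r' assume r: "r \<in> unit_cube" "r' \<in> unit_cube" "grid_eq K P r r'" "r \<in> cyl k a"
  then obtain u where u: "u \<in> {0..<1}" "r(k := u) \<in> a" by (auto simp: cyl_def)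
  have "grid_eq K P (r(k := u)) (r'(k := u))" using r by (auto simp: grid_eq_def)
  then have "r'(k := u) \<in> a"
    using grid_invariantD[OF assms unit_cube_upd[OF r(1) u(1)] unit_cube_upd[OF r(2) u(1)]] u(2)
    by simp
  then show "r' \<in> cyl k a" using u r by (auto simp: cyl_def)
qed

text \<open>After the substitution, coordinate \<open>k\<close> carries the value
  \<open>r l\<close>, so the comparisons at \<open>l\<close> must be known too; hence
  \<open>l\<close> joins \<open>K\<close>.\<close>

lemma grid_invariant_subst_set:
  assumes "grid_invariant K P a"
  shows "grid_invariant (insert l K) P (subst_set a k l)"
  unfolding grid_invariant_def
proof (intro ballI impI)
  fix r r' assume r: "r \<in> unit_cube" "r' \<in> unit_cube" "grid_eq (insert l K) P r r'"
    "r \<in> subst_set a k l"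
  then have "r(k := r l) \<in> a" by (auto simp: subst_set_def)
  moreover have "grid_eq K P (r(k := r l)) (r'(k := r' l))" using r by (auto simp: grid_eq_def)
  moreover have "r(k := r l) \<in> unit_cube" "r'(k := r' l) \<in> unit_cube"
    using r by (auto simp: unit_cube_upd unit_cube_apply)
  ultimately have "r'(k := r' l) \<in> a"
    using grid_invariantD[OF assms] by simp
  then show "r' \<in> subst_set a k l" using r by (auto simp: subst_set_def)
qed

section \<open>Characterization of the box algebra by grid invariance\<close>

text \<open>Forwards, the finite grids of the boxes are merged by induction on the union. Backwards,
  \<open>a\<close> is the union of the cells of its points, which are boxes and finite in
  number.\<close>

lemma box_algebra_iff:
  fixes a :: "('k::wellorder \<Rightarrow> real) set"
  shows "a \<in> box_algebra \<longleftrightarrow>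
    a \<subseteq> unit_cube \<and> (\<exists>K P. finite K \<and> finite P \<and> grid_invariant K P a)"
proof
  assume "a \<in> box_algebra"
  then obtain F where F: "finite F" "a = \<Union>F"
    and "F \<subseteq> {fin_box n k s t |n k s t. box_data n k s t}"
    by (auto simp: box_algebra_def)
  from F(1) this(3)
  have "\<Union>F \<subseteq> unit_cube \<and> (\<exists>K P. finite K \<and> finite P \<and> grid_invariant K P (\<Union>F))"
  proof induction
    case empty
    have "grid_invariant {} {} {}" by (simp add: grid_invariant_def)
    then show ?case by auto
  next
    case (insert b F)
    from insert obtain K P where KP: "finite K" "finite P" "grid_invariant K P (\<Union>F)"
      and sub: "\<Union>F \<subseteq> unit_cube" by auto
    from insert.prems obtain n k s t where b: "b = fin_box n k s t" by blast
    let ?K = "k ` {1..n} \<union> K" and ?P = "s ` {1..n} \<union> t ` {1..n} \<union> P"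
    have "grid_invariant ?K ?P (\<Union>(insert b F))"
      unfolding b Union_insert by (intro grid_invariant_Un grid_invariant_fin_box KP)
    moreover have "finite ?K" "finite ?P" using KP by auto
    moreover have "\<Union>(insert b F) \<subseteq> unit_cube"
      using sub fin_box_subset[of n k s t] unfolding b by auto
    ultimately show ?case by (intro conjI exI[of _ ?K] exI[of _ ?P])
  qed
  then show "a \<subseteq> unit_cube \<and> (\<exists>K P. finite K \<and> finite P \<and> grid_invariant K P a)"
    using F by simp
next
  assume "a \<subseteq> unit_cube \<and> (\<exists>K P. finite K \<and> finite P \<and> grid_invariant K P a)"
  then obtain K P where sub: "a \<subseteq> unit_cube" and fin: "finite K" "finite P"
    and inv: "grid_invariant K P a" by auto
  define c where "c r = {r'\<in>unit_cube. grid_eq K P r r'}" for r :: "'k \<Rightarrow> real"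
  \<comment> \<open>\<open>h Q\<close> is the set of points whose true comparisons are exactly those
    in \<open>Q\<close>. Each cell is some \<open>h Q\<close> with
    \<open>Q \<subseteq> K \<times> P\<close>, which bounds the number of cells.\<close>
  define h where "h Q = {r'\<in>unit_cube. \<forall>k\<in>K. \<forall>p\<in>P. (k, p) \<in> Q \<longleftrightarrow> p \<le> r' k}"
    for Q :: "('k \<times> real) set"
  have "c ` a \<subseteq> h ` Pow (K \<times> P)"
  proof (rule image_subsetI)
    fix r
    have "c r = h {(k, p). k \<in> K \<and> p \<in> P \<and> p \<le> r k}"
      unfolding c_def h_def grid_eq_def by auto
    then show "c r \<in> h ` Pow (K \<times> P)" by (rule image_eqI) auto
  qed
  then have "finite (c ` a)" by (rule finite_subset) (simp add: fin)
  moreover have "c ` a \<subseteq> {fin_box n k s t |n k s t. box_data n k s t}"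
  proof
    fix b assume "b \<in> c ` a"
    then obtain r where "r \<in> unit_cube" "b = c r" using sub by auto
    moreover from grid_cell_is_box[OF fin this(1)] obtain n k s t
      where "box_data n k s t" "c r = fin_box n k s t" unfolding c_def by metis
    ultimately show "b \<in> {fin_box n k s t |n k s t. box_data n k s t}" by blast
  qed
  moreover have "\<Union>(c ` a) = a"
  proof
    show "\<Union>(c ` a) \<subseteq> a"
      unfolding c_def using grid_invariantD[OF inv] sub by auto
    show "a \<subseteq> \<Union>(c ` a)"
      unfolding c_def using sub by (auto simp: grid_eq_def)
  qed
  ultimately show "a \<in> box_algebra"
    unfolding box_algebra_def by (intro CollectI exI[of _ "c ` a"]) simp
qed

section \<open>Closure properties of the box algebra\<close>

lemma box_algebraI:
  "finite K \<Longrightarrow> finite P \<Longrightarrow> grid_invariant K P a \<Longrightarrow> a \<subseteq> unit_cube \<Longrightarrow> a \<in> box_algebra"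
  by (simp add: box_algebra_iff) (intro exI conjI)

lemma box_algebraE:
  assumes "a \<in> box_algebra"
  obtains K P where "finite K" "finite P" "grid_invariant K P a" "a \<subseteq> unit_cube"
  using assms by (auto simp: box_algebra_iff)

lemma cyl_box_algebra:
  assumes "a \<in> box_algebra"
  shows "cyl k a \<in> box_algebra"
proof -
  obtain K P where KP: "finite K" "finite P" "grid_invariant K P a"
    using assms by (rule box_algebraE)
  show ?thesis
    using KP(1,2) grid_invariant_cyl[OF KP(3)] by (rule box_algebraI) (auto simp: cyl_def)
qed

lemma subst_set_box_algebra:
  assumes "a \<in> box_algebra"
  shows "subst_set a k l \<in> box_algebra"
proof -
  obtain K P where KP: "finite K" "finite P" "grid_invariant K P a"
    using assms by (rule box_algebraE)
  have "finite (insert l K)" using KP by simp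
  then show ?thesis
    using KP(2) grid_invariant_subst_set[OF KP(3)] by (rule box_algebraI) (auto simp: subst_set_def)
qed

lemma algebra_box_algebra: "algebra unit_cube (box_algebra :: ('k::wellorder \<Rightarrow> real) set set)"
  unfolding algebra_iff_Un
proof (intro conjI ballI)
  show "box_algebra \<subseteq> Pow (unit_cube :: ('k \<Rightarrow> real) set)"
    by (auto elim: box_algebraE)
  show "{} \<in> (box_algebra :: ('k \<Rightarrow> real) set set)"
    by (rule box_algebraI[of "{}" "{}"]) (auto simp: grid_invariant_def)
next
  fix a :: "('k \<Rightarrow> real) set" assume "a \<in> box_algebra"
  then obtain K P where "finite K" "finite P" "grid_invariant K P a" by (rule box_algebraE)
  then show "unit_cube - a \<in> box_algebra"
    using grid_invariant_Diff by (intro box_algebraI[of K P]) auto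
next
  fix a b :: "('k \<Rightarrow> real) set" assume "a \<in> box_algebra" "b \<in> box_algebra"
  then obtain K P K' P' where KP: "finite K" "finite P" "finite K'" "finite P'"
    and inv: "grid_invariant K P a" "grid_invariant K' P' b"
    and sub: "a \<subseteq> unit_cube" "b \<subseteq> unit_cube"
    by (elim box_algebraE)
  show "a \<union> b \<in> box_algebra"
    using KP sub by (intro box_algebraI[OF _ _ grid_invariant_Un[OF inv]]) auto
qed

section \<open>Product measure of cylinders and boxes\<close>

interpretation cube: product_prob_space "\<lambda>_. lebesgue_on {0..<1::real}" "UNIV :: 'k set"
  by (intro product_prob_spaceI prob_spaceI) (simp add: space_restrict_space emeasure_restrict_space)

lemma space_cube_measure: "space cube_measure = unit_cube"
  by (simp add: cube_measure_def space_PiM space_restrict_space unit_cube_def PiE_UNIV_domain)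

lemma emeasure_cube_cylinder:
  assumes "finite J" "\<And>k. k \<in> J \<Longrightarrow> X k \<in> sets (lebesgue_on {0..<1})"
  shows "emeasure cube_measure {r\<in>unit_cube. \<forall>k\<in>J. r k \<in> X k}
    = (\<Prod>k\<in>J. emeasure (lebesgue_on {0..<1}) (X k))"
  using cube.emeasure_PiM_Collect[OF subset_UNIV assms]
  unfolding cube_measure_def[symmetric] space_cube_measure by simp

lemma sets_cube_cylinder:
  assumes "finite J" "\<And>k. k \<in> J \<Longrightarrow> X k \<in> sets (lebesgue_on {0..<1})"
  shows "{r\<in>unit_cube. \<forall>k\<in>J. r k \<in> X k} \<in> sets cube_measure"
proof -
  have "{r\<in>space cube_measure. r k \<in> X k} \<in> sets cube_measure" if "k \<in> J" for k
    using measurable_sets_Collect[of "\<lambda>r. r k" cube_measure "lebesgue_on {0..<1}" "\<lambda>x. x \<in> X k"]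
      assms(2)[OF that] sets.sets_into_space[OF assms(2)[OF that]]
    unfolding cube_measure_def by (simp add: Collect_conj_eq Int_absorb1)
  then show ?thesis
    using assms(1) unfolding space_cube_measure[symmetric]
    by (intro sets.sets_Collect_finite_All) auto
qed

lemma sets_lebesgue_on_atLeastLessThan:
  "0 \<le> s \<Longrightarrow> t \<le> 1 \<Longrightarrow> {s..<t} \<in> sets (lebesgue_on {0..<1::real})"
  by (subst sets_restrict_space_iff) auto

lemma emeasure_lebesgue_on_atLeastLessThan:
  assumes "0 \<le> s" "s \<le> t" "t \<le> (1::real)"
  shows "emeasure (lebesgue_on {0..<1}) {s..<t} = ennreal (t - s)"
  using assms by (subst emeasure_restrict_space) auto

lemma box_data_inj_on: "box_data n k s t \<Longrightarrow> inj_on k {1..n}"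
  unfolding box_data_def using strict_mono_on_imp_inj_on by blast

text \<open>The product measure indexes its factors by coordinates, a box by positions; inverting
  \<open>k\<close> passes from one to the other.\<close>

lemma fin_box_eq_cylinder:
  assumes "inj_on k {1..n}"
  shows "fin_box n k s t = {r\<in>unit_cube. \<forall>i\<in>k ` {1..n}.
    r i \<in> {s (the_inv_into {1..n} k i)..<t (the_inv_into {1..n} k i)}}"
  using assms by (simp add: fin_box_def the_inv_into_f_f)

lemma emeasure_fin_box:
  assumes "box_data n k s t"
  shows "emeasure cube_measure (fin_box n k s t) = ennreal (\<Prod>j=1..n. t j - s j)"
proof -
  let ?g = "the_inv_into {1..n} k"
  have inj: "inj_on k {1..n}" using assms by (rule box_data_inj_on)
  have g: "?g i \<in> {1..n}" if "i \<in> k ` {1..n}" for i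
    using the_inv_into_into[OF inj that] by blast
  have st: "0 \<le> s j" "s j \<le> t j" "t j \<le> 1" if "j \<in> {1..n}" for j
    using assms that by (force simp: box_data_def)+
  have "emeasure cube_measure (fin_box n k s t)
      = (\<Prod>i\<in>k ` {1..n}. emeasure (lebesgue_on {0..<1}) {s (?g i)..<t (?g i)})"
    unfolding fin_box_eq_cylinder[OF inj]
    using st g by (intro emeasure_cube_cylinder sets_lebesgue_on_atLeastLessThan) blast+
  also have "\<dots> = (\<Prod>j=1..n. emeasure (lebesgue_on {0..<1}) {s j..<t j})"
    unfolding prod.reindex[OF inj] by (intro prod.cong) (simp_all add: the_inv_into_f_f[OF inj] del: One_nat_def)
  also have "\<dots> = (\<Prod>j=1..n. ennreal (t j - s j))"
    using st by (intro prod.cong emeasure_lebesgue_on_atLeastLessThan) auto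
  also have "\<dots> = ennreal (\<Prod>j=1..n. t j - s j)"
    using st by (intro prod_ennreal) (simp add: algebra_simps)
  finally show ?thesis .
qed

lemma sets_fin_box:
  assumes "box_data n k s t"
  shows "fin_box n k s t \<in> sets cube_measure"
proof -
  have inj: "inj_on k {1..n}" using assms by (rule box_data_inj_on)
  show ?thesis
    unfolding fin_box_eq_cylinder[OF inj]
    using assms by (intro sets_cube_cylinder sets_lebesgue_on_atLeastLessThan)
      (auto simp: box_data_def the_inv_into_f_f[OF inj] simp del: One_nat_def)
qed

lemma box_algebra_subset_sets: "box_algebra \<subseteq> sets cube_measure"
  unfolding box_algebra_def
  by (auto intro!: sets.finite_Union sets_fin_box dest: subsetD)

section \<open>The measure of a cylindrification\<close>

lemma null_sets_avoid_interval:
  fixes ys :: "nat \<Rightarrow> 'k"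
  assumes inj: "inj_on ys {1..}" and q: "0 \<le> q" "q < q'" "q' \<le> 1"
  shows "{r\<in>unit_cube. \<forall>i\<ge>1. r (ys i) \<notin> {q..<q'}} \<in> null_sets cube_measure"
proof -
  let ?X = "{0..<1} - {q..<q'}"
  define E where "E n = {r\<in>unit_cube. \<forall>k\<in>ys ` {1..n}. r k \<in> ?X}" for n
  have X: "?X \<in> sets (lebesgue_on {0..<1})"
    using q by (intro sets.Diff sets_lebesgue_on_atLeastLessThan) auto
  have mX: "emeasure (lebesgue_on {0..<1}) ?X = ennreal (1 - (q' - q))"
    using q by (subst emeasure_Diff)
      (auto simp: emeasure_lebesgue_on_atLeastLessThan sets_lebesgue_on_atLeastLessThan
        simp flip: ennreal_1 ennreal_minus)
  have E: "E n \<in> sets cube_measure" for n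
    unfolding E_def by (intro sets_cube_cylinder X) auto
  have mE: "emeasure cube_measure (E n) = ennreal ((1 - (q' - q)) ^ n)" for n
  proof -
    \<comment> \<open>Distinctness of the \<open>ys i\<close> enters here: \<open>E n\<close>
      constrains exactly \<open>n\<close> coordinates, each contributing a factor
      \<open>1 - (q' - q)\<close>.\<close>
    have "card (ys ` {1..n}) = n"
      using inj by (subst card_image) (auto intro: inj_on_subset)
    then show ?thesis
      unfolding E_def using q X by (subst emeasure_cube_cylinder) (auto simp: mX ennreal_power)
  qed
  have eq: "{r\<in>unit_cube. \<forall>i\<ge>1. r (ys i) \<notin> {q..<q'}} = (\<Inter>n. E n)"
    unfolding E_def using unit_cube_apply by fastforce
  have "emeasure cube_measure (\<Inter>n. E n) \<le> ennreal ((1 - (q' - q)) ^ n)" for n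
    unfolding mE[symmetric] by (intro emeasure_mono E) auto
  \<comment> \<open>The base lies in [0,1) because \<open>0 < q' - q\<close> and
    \<open>q' - q \<le> 1\<close>.\<close>
  moreover have "(\<lambda>n. ennreal ((1 - (q' - q)) ^ n)) \<longlonglongrightarrow> ennreal 0"
    using q by (intro tendsto_ennrealI LIMSEQ_realpow_zero) auto
  ultimately have "emeasure cube_measure (\<Inter>n. E n) \<le> 0"
    by (intro LIMSEQ_le_const) auto
  then show ?thesis
    unfolding eq using E by (intro null_setsI) auto
qed

text \<open>The unions increase inside \<open>cyl y a\<close> and exhaust it up to a null set. The
  interval that a point must avoid depends on the point; rational end points leave only countably
  many exceptional sets \<open>Z q q'\<close>.\<close>

lemma emeasure_cyl_eq_SUP:
  fixes a :: "('k::wellorder \<Rightarrow> real) set" and ys :: "nat \<Rightarrow> 'k"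
  assumes a: "a \<in> box_algebra" and inj: "inj_on ys {1..}"
  shows "emeasure cube_measure (cyl y a) =
    (SUP n. emeasure cube_measure (\<Union>i\<in>{1..n}. subst_set a y (ys i)))"
proof -
  obtain K P where "finite P" and inv: "grid_invariant K P a"
    using a by (rule box_algebraE)
  define U where "U n = (\<Union>i\<in>{1..n}. subst_set a y (ys i))" for n
  define Z where "Z q q' = {r\<in>unit_cube. \<forall>i\<ge>1. r (ys i) \<notin> {real_of_rat q..<real_of_rat q'}}"
    for q q'
  define Q where "Q = {(q, q').
    0 \<le> real_of_rat q \<and> real_of_rat q < real_of_rat q' \<and> real_of_rat q' \<le> 1}"
  have meas: "U n \<in> sets cube_measure" "cyl y a \<in> sets cube_measure" for n
    using a box_algebra_subset_sets unfolding U_def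
    by (auto intro!: sets.finite_UN subst_set_box_algebra cyl_box_algebra dest: subsetD)
  have null: "(\<Union>(q, q')\<in>Q. Z q q') \<in> null_sets cube_measure"
    using null_sets_avoid_interval[OF inj]
    by (intro null_sets_UN') (auto simp: Q_def Z_def)
  \<comment> \<open>The value \<open>r (ys i)\<close> itself is a witness for the
    cylindrification.\<close>
  have sub: "(\<Union>n. U n) \<subseteq> cyl y a"
    unfolding U_def subst_set_def cyl_def using unit_cube_apply by fastforce
  have diff: "cyl y a - (\<Union>n. U n) \<subseteq> (\<Union>(q, q')\<in>Q. Z q q')"
  proof
    fix r assume r: "r \<in> cyl y a - (\<Union>n. U n)"
    then obtain u where u: "0 \<le> u" "u < 1" "r(y := u) \<in> a" and rc: "r \<in> unit_cube"
      by (auto simp: cyl_def)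
    obtain s t where st: "0 \<le> s" "s \<le> u" "u < t" "t \<le> 1"
      and cell: "\<And>v. 0 \<le> v \<Longrightarrow> v < 1 \<Longrightarrow> (\<forall>p\<in>P. p \<le> u \<longleftrightarrow> p \<le> v) \<longleftrightarrow> v \<in> {s..<t}"
      using grid_cell_interval[OF \<open>finite P\<close> u(1,2)] by metis
    \<comment> \<open>The interval from \<open>q\<close> to \<open>q'\<close> has to lie in the cell
      of \<open>u\<close> but need not contain \<open>u\<close>: all values in that cell are
      interchangeable at coordinate \<open>y\<close>.\<close>
    obtain q where q: "s < real_of_rat q" "real_of_rat q < t"
      using of_rat_dense[of s t] st by auto
    obtain q' where q': "real_of_rat q < real_of_rat q'" "real_of_rat q' < t"
      using of_rat_dense[OF q(2)] by blast
    have "r (ys i) \<notin> {real_of_rat q..<real_of_rat q'}" if "i \<ge> 1" for i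
    proof
      assume "r (ys i) \<in> {real_of_rat q..<real_of_rat q'}"
      then have "r (ys i) \<in> {s..<t}" using q q' by auto
      then have "\<forall>p\<in>P. p \<le> u \<longleftrightarrow> p \<le> r (ys i)"
        using cell unit_cube_apply[OF rc] by blast
      \<comment> \<open>The two points agree off \<open>y\<close>, and at \<open>y\<close> their
        values lie in the same cell.\<close>
      then have "grid_eq K P (r(y := u)) (r(y := r (ys i)))"
        by (auto simp: grid_eq_def)
      moreover have "r(y := u) \<in> unit_cube" "r(y := r (ys i)) \<in> unit_cube"
        using u rc by (auto simp: unit_cube_upd unit_cube_apply)
      ultimately have "r(y := r (ys i)) \<in> a"
        using u(3) grid_invariantD[OF inv] by simp
      \<comment> \<open>\<open>i \<ge> 1\<close> puts \<open>i\<close> into the index range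
        \<open>{1..i}\<close> of \<open>U i\<close>.\<close>
      then have "r \<in> U i" using rc that by (auto simp: U_def subst_set_def)
      then show False using r by blast
    qed
    then have "r \<in> Z q q'" using rc by (auto simp: Z_def)
    moreover have "(q, q') \<in> Q"
    proof -
      have "0 \<le> real_of_rat q" "real_of_rat q' \<le> 1" using q q' st by linarith+
      then show ?thesis using q'(1) unfolding Q_def by blast
    qed
    ultimately show "r \<in> (\<Union>(q, q')\<in>Q. Z q q')" by blast
  qed
  \<comment> \<open>Being measurable, the difference inherits nullity from the set that covers
    it.\<close>
  have "cyl y a - (\<Union>n. U n) \<in> null_sets cube_measure"
    using null_sets_subset[OF null _ diff] meas by auto
  then have eq: "emeasure cube_measure (cyl y a) = emeasure cube_measure (\<Union>n. U n)"
    using emeasure_Un_null_set[of "\<Union>n. U n" cube_measure "cyl y a - (\<Union>n. U n)"] meas sub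
    by (simp add: Un_absorb1 sets.countable_UN)
  have "incseq U"
    unfolding U_def by (intro incseq_SucI UN_mono) auto
  then have "emeasure cube_measure (\<Union>n. U n) = (SUP n. emeasure cube_measure (U n))"
    using meas by (intro SUP_emeasure_incseq[symmetric]) auto
  with eq show ?thesis unfolding U_def by simp
qed

theorem theorem3:
  assumes "infinite (UNIV :: 'k::wellorder set)"
  shows "polyadic_set_algebra (box_algebra :: ('k \<Rightarrow> real) set set) \<and>
    (box_algebra :: ('k \<Rightarrow> real) set set) \<subseteq> sets cube_measure \<and>
    (\<forall>n (k :: nat \<Rightarrow> 'k) s t. box_data n k s t \<longrightarrow>
      emeasure cube_measure (fin_box n k s t) = ennreal (\<Prod>j=1..n. t j - s j)) \<and>
    (\<forall>a \<in> (box_algebra :: ('k \<Rightarrow> real) set set). \<forall>y \<in> dim_set a. \<forall>ys :: nat \<Rightarrow> 'k.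
      inj_on ys {1..} \<and> (\<forall>i\<ge>1. ys i \<notin> dim_set a) \<longrightarrow>
      emeasure cube_measure (cyl y a) =
        (SUP n. emeasure cube_measure (\<Union>i\<in>{1..n}. subst_set a y (ys i))))"
  using algebra_box_algebra cyl_box_algebra subst_set_box_algebra box_algebra_subset_sets
    emeasure_fin_box emeasure_cyl_eq_SUP
  unfolding polyadic_set_algebra_def by blast

end
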